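(* Let $n\ge 2$, let $m\ge 1$ and let $w\in W(\tilde A_n)$ with $L(w)=m$ be given as $$w=\mathcal B(j_1,i_1)\mathcal B(j_2,i_2)\cdots\mathcal B(j_m,i_m)\,x,\qquad x\in W(A_n),$$ where the family of integers $(j_s,i_s)_{1\le s\le m}$ satisfies the pairwise inequalities. Then $$\mathscr R(x)\subseteq\mathscr R(w)\subseteq\mathscr R(x)\cup\{a_{n+1}\}.$$ Equivalently, either $\mathscr R(w)=\mathscr R(x)$ or $\mathscr R(w)=\mathscr R(x)\cup\{a_{n+1}\}$.
   Context: $W(\tilde A_n)$ ($n\ge 2$) is the affine Coxeter group of type $\tilde A_n$ with generators $S_n=\{\sigma_1,\dots,\sigma_n,a_{n+1}\}$ whose Coxeter diagram is the $(n+1)$-cycle $\sigma_1-\sigma_2-\cdots-\sigma_n-a_{n+1}-\sigma_1$ (all edges of order 3). $W(A_n)$ is the parabolic subgroup generated by $\sigma_1,\dots,\sigma_n$. $l$ is the Coxeter length, and $\mathscr R(w)=\{s\in S_n : l(ws)<l(w)\}$. The affine length $L(w)$ is the minimal number of occurrences of $a_{n+1}$ in the reduced expressions of $w$. Notation: $\lfloor i,j\rfloor=\sigma_i\sigma_{i+1}\cdots\sigma_j$ for $1\le i\le j\le n$, and $\lfloor n+1,n\rfloor=1$; $\lceil i,j\rceil=\sigma_i\sigma_{i-1}\cdots\sigma_j$ for $1\le j\le i\le n$, and $\lceil 0,1\rceil=1$; $h(r,i)=\lfloor r,n\rfloor\lceil i,1\rceil$ and $\mathcal B(r,i)=h(r,i)\,a_{n+1}$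 for $0\le i\le n-1$, $1\le r\le n+1$. Pairwise inequalities: a family of integers $(j_s,i_s)_{1\le s\le m}$ satisfies the pairwise inequalities if: (1) $1\le j_1\le n+1$ and $0\le i_1\le n-1$; (2) for $2\le s\le m$, either $i_s=0$ and $j_s=1$, or $1\le i_s\le n-1$ and $1\le j_s\le n$; (3) for $2\le s\le m$, $j_s\le j_{s-1}$ and $i_s\ge i_{s-1}$; (4) for $2\le s\le m$, if $j_{s-1}>i_{s-1}+1$ then $j_s<j_{s-1}$; (5) for $2\le s\le m$, if $j_s>i_s+1$ then $i_s>i_{s-1}$. *)

theory Defs
  imports "HOL-Algebra.Generated_Groups"
begin

section \<open>Coxeter groups by generators and relations\<close>

text \<open>
  Equality of words over \<open>S\<close> modulo the relations \<open>(s t) ^ m s t = 1\<close>.  For a Coxeter matrix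
  \<open>m s s = 1\<close>, hence every generator is an involution, words in positive powers of the generators
  suffice, and the quotient monoid is the group with this presentation.
\<close>

inductive coxeter_eq :: "'a set \<Rightarrow> ('a \<Rightarrow> 'a \<Rightarrow> nat) \<Rightarrow> 'a list \<Rightarrow> 'a list \<Rightarrow> bool"
  for S :: "'a set" and m :: "'a \<Rightarrow> 'a \<Rightarrow> nat" where
  relation: "\<lbrakk>u \<in> lists S; v \<in> lists S; s \<in> S; t \<in> S\<rbrakk>
    \<Longrightarrow> coxeter_eq S m (u @ concat (replicate (m s t) [s, t]) @ v) (u @ v)"
| refl: "u \<in> lists S \<Longrightarrow> coxeter_eq S m u u"
| sym: "coxeter_eq S m u v \<Longrightarrow> coxeter_eq S m v u"
| trans: "\<lbrakk>coxeter_eq S m u v; coxeter_eq S m v w\<rbrakk> \<Longrightarrow> coxeter_eq S m u w"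

definition coxeter_rel :: "'a set \<Rightarrow> ('a \<Rightarrow> 'a \<Rightarrow> nat) \<Rightarrow> ('a list \<times> 'a list) set" where
  "coxeter_rel S m = {(u, v). coxeter_eq S m u v}"

definition coxeter_group :: "'a set \<Rightarrow> ('a \<Rightarrow> 'a \<Rightarrow> nat) \<Rightarrow> 'a list set monoid" where
  "coxeter_group S m = \<lparr>
     carrier = lists S // coxeter_rel S m,
     mult = (\<lambda>X Y. \<Union>u\<in>X. \<Union>v\<in>Y. coxeter_rel S m `` {u @ v}),
     one = coxeter_rel S m `` {[]}\<rparr>"

definition coxeter_gen :: "'a set \<Rightarrow> ('a \<Rightarrow> 'a \<Rightarrow> nat) \<Rightarrow> 'a \<Rightarrow> 'a list set" where
  "coxeter_gen S m s = coxeter_rel S m `` {[s]}"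

lemma coxeter_eq_lists:
  "coxeter_eq S m u v \<Longrightarrow> u \<in> lists S \<and> v \<in> lists S"
proof (induction rule: coxeter_eq.induct)
  case (relation u v s t)
  then show ?case by (auto simp: in_lists_conv_set)
qed auto

lemma equiv_coxeter_rel: "equiv (lists S) (coxeter_rel S m)"
proof (rule equivI)
  show "coxeter_rel S m \<subseteq> lists S \<times> lists S"
    using coxeter_eq_lists unfolding coxeter_rel_def by blast
  show "refl_on (lists S) (coxeter_rel S m)"
    by (auto simp: refl_on_def coxeter_rel_def intro: coxeter_eq.refl)
  show "Relation.sym (coxeter_rel S m)"
    by (auto intro!: symI simp: coxeter_rel_def intro: coxeter_eq.sym)
  show "Relation.trans (coxeter_rel S m)"
    by (auto intro!: transI simp: coxeter_rel_def intro: coxeter_eq.trans)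
qed

lemma coxeter_eq_append_left:
  assumes "coxeter_eq S m u v" "p \<in> lists S"
  shows "coxeter_eq S m (p @ u) (p @ v)"
  using assms
proof (induction rule: coxeter_eq.induct)
  case (relation u v s t)
  then show ?case using coxeter_eq.relation[of "p @ u" S v s t m] by simp
next
  case (refl u)
  then show ?case by (intro coxeter_eq.refl) simp
next
  case (sym u v)
  then show ?case by (blast intro: coxeter_eq.sym)
next
  case (trans u v w)
  then show ?case by (blast intro: coxeter_eq.trans)
qed

lemma coxeter_eq_append_right:
  assumes "coxeter_eq S m u v" "p \<in> lists S"
  shows "coxeter_eq S m (u @ p) (v @ p)"
  using assms
proof (induction rule: coxeter_eq.induct)
  case (relation u v s t)
  then show ?case using coxeter_eq.relation[of u S "v @ p" s t m] by simp
next
  case (refl u)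
  then show ?case by (intro coxeter_eq.refl) simp
next
  case (sym u v)
  then show ?case by (blast intro: coxeter_eq.sym)
next
  case (trans u v w)
  then show ?case by (blast intro: coxeter_eq.trans)
qed

lemma coxeter_eq_append:
  assumes "coxeter_eq S m u u'" "coxeter_eq S m v v'"
  shows "coxeter_eq S m (u @ v) (u' @ v')"
proof (rule coxeter_eq.trans)
  show "coxeter_eq S m (u @ v) (u' @ v)"
    using assms coxeter_eq_lists[OF assms(2)] by (intro coxeter_eq_append_right) auto
  show "coxeter_eq S m (u' @ v) (u' @ v')"
    using assms coxeter_eq_lists[OF assms(1)] by (intro coxeter_eq_append_left) auto
qed

lemma coxeter_mult_class:
  assumes "u \<in> lists S" "v \<in> lists S"
  shows "(coxeter_rel S m `` {u}) \<otimes>\<^bsub>coxeter_group S m\<^esub> (coxeter_rel S m `` {v})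
    = coxeter_rel S m `` {u @ v}"
proof -
  have "coxeter_rel S m `` {a @ b} = coxeter_rel S m `` {u @ v}"
    if "a \<in> coxeter_rel S m `` {u}" "b \<in> coxeter_rel S m `` {v}" for a b
  proof -
    have "(u @ v, a @ b) \<in> coxeter_rel S m"
      using that coxeter_eq_append[of S m u a v b] by (simp add: coxeter_rel_def)
    then show ?thesis by (rule equiv_class_eq[OF equiv_coxeter_rel, symmetric])
  qed
  moreover have "u \<in> coxeter_rel S m `` {u}" "v \<in> coxeter_rel S m `` {v}"
    using assms by (auto simp: coxeter_rel_def intro: coxeter_eq.refl)
  ultimately have "(\<Union>a\<in>coxeter_rel S m `` {u}. \<Union>b\<in>coxeter_rel S m `` {v}. coxeter_rel S m `` {a @ b})
      = coxeter_rel S m `` {u @ v}"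
    by blast
  then show ?thesis by (simp add: coxeter_group_def)
qed

lemma coxeter_eq_rev_cancel:
  assumes "\<And>s. s \<in> S \<Longrightarrow> m s s = 1" "u \<in> lists S"
  shows "coxeter_eq S m (rev u @ u) []"
  using assms(2)
proof (induction u)
  case Nil
  then show ?case by (simp add: coxeter_eq.refl)
next
  case (Cons s u)
  then have "coxeter_eq S m (rev u @ [s, s] @ u) (rev u @ u)"
    using coxeter_eq.relation[of "rev u" S u s s m] assms(1)[of s] by (auto simp: in_lists_conv_set)
  with Cons.IH have "coxeter_eq S m (rev u @ [s, s] @ u) []"
    by (rule coxeter_eq.trans[rotated])
  then show ?case by simp
qed

lemma group_coxeter_group:
  assumes "\<And>s. s \<in> S \<Longrightarrow> m s s = 1"
  shows "group (coxeter_group S m)"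
proof (rule groupI)
  let ?G = "coxeter_group S m"
  have car: "X \<in> carrier ?G \<longleftrightarrow> (\<exists>u\<in>lists S. X = coxeter_rel S m `` {u})" for X
    by (auto simp: coxeter_group_def quotient_def)
  have one: "\<one>\<^bsub>?G\<^esub> = coxeter_rel S m `` {[]}"
    by (simp add: coxeter_group_def)
  show "\<one>\<^bsub>?G\<^esub> \<in> carrier ?G"
    unfolding car one by (rule bexI[of _ "[]"]) auto
  show "X \<otimes>\<^bsub>?G\<^esub> Y \<in> carrier ?G" if XY: "X \<in> carrier ?G" "Y \<in> carrier ?G" for X Y
  proof -
    obtain u v where "u \<in> lists S" "v \<in> lists S"
      "X = coxeter_rel S m `` {u}" "Y = coxeter_rel S m `` {v}" using XY car by metis
    then show ?thesis unfolding car
      by (intro bexI[of _ "u @ v"]) (simp_all add: coxeter_mult_class)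
  qed
  show "X \<otimes>\<^bsub>?G\<^esub> Y \<otimes>\<^bsub>?G\<^esub> Z = X \<otimes>\<^bsub>?G\<^esub> (Y \<otimes>\<^bsub>?G\<^esub> Z)"
    if XYZ: "X \<in> carrier ?G" "Y \<in> carrier ?G" "Z \<in> carrier ?G" for X Y Z
  proof -
    obtain u v w where "u \<in> lists S" "v \<in> lists S" "w \<in> lists S"
      "X = coxeter_rel S m `` {u}" "Y = coxeter_rel S m `` {v}" "Z = coxeter_rel S m `` {w}"
      using XYZ car by metis
    then show ?thesis
      by (simp add: coxeter_mult_class)
  qed
  show "\<one>\<^bsub>?G\<^esub> \<otimes>\<^bsub>?G\<^esub> X = X" if X: "X \<in> carrier ?G" for X
  proof -
    obtain u where "u \<in> lists S" "X = coxeter_rel S m `` {u}" using X car by metis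
    then show ?thesis using coxeter_mult_class[of "[]" S u m] by (simp add: one)
  qed
  show "\<exists>Y\<in>carrier ?G. Y \<otimes>\<^bsub>?G\<^esub> X = \<one>\<^bsub>?G\<^esub>" if X: "X \<in> carrier ?G" for X
  proof -
    obtain u where u: "u \<in> lists S" "X = coxeter_rel S m `` {u}" using X car by metis
    then have ru: "rev u \<in> lists S" by (auto simp: in_lists_conv_set)
    have "coxeter_rel S m `` {rev u @ u} = coxeter_rel S m `` {[]}"
      using coxeter_eq_rev_cancel[of S m u] assms u(1)
      by (intro equiv_class_eq[OF equiv_coxeter_rel]) (simp add: coxeter_rel_def)
    then have "coxeter_rel S m `` {rev u} \<otimes>\<^bsub>?G\<^esub> X = \<one>\<^bsub>?G\<^esub>"
      using u ru by (simp add: coxeter_mult_class one)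
    moreover have "coxeter_rel S m `` {rev u} \<in> carrier ?G" using ru car by blast
    ultimately show ?thesis by blast
  qed
qed


section \<open>Length, reduced expressions and right descents\<close>

definition word_prod :: "('a, 'b) monoid_scheme \<Rightarrow> 'a list \<Rightarrow> 'a" where
  "word_prod G xs = foldr (\<otimes>\<^bsub>G\<^esub>) xs \<one>\<^bsub>G\<^esub>"

definition coxeter_length :: "('a, 'b) monoid_scheme \<Rightarrow> 'a set \<Rightarrow> 'a \<Rightarrow> nat" where
  "coxeter_length G S w = (LEAST k. \<exists>xs \<in> lists S. word_prod G xs = w \<and> length xs = k)"

definition reduced_expressions :: "('a, 'b) monoid_scheme \<Rightarrow> 'a set \<Rightarrow> 'a \<Rightarrow> 'a list set" where
  "reduced_expressions G S w =
     {xs \<in> lists S. word_prod G xs = w \<and> length xs = coxeter_length G S w}"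

definition right_descents :: "('a, 'b) monoid_scheme \<Rightarrow> 'a set \<Rightarrow> 'a \<Rightarrow> 'a set" where
  "right_descents G S w = {s \<in> S. coxeter_length G S (w \<otimes>\<^bsub>G\<^esub> s) < coxeter_length G S w}"


section \<open>The affine group of type A\<close>

text \<open>
  Node \<open>k\<close> with \<open>1 \<le> k \<le> n\<close> of the diagram is \<open>\<sigma>\<^sub>k\<close>; node \<open>n + 1\<close> is the affine generator.
  For \<open>n \<ge> 2\<close> the adjacency below is that of the \<open>(n + 1)\<close>-cycle.
\<close>

definition affine_A_adj :: "nat \<Rightarrow> nat \<Rightarrow> nat \<Rightarrow> bool" where
  "affine_A_adj n s t \<longleftrightarrow> t = s + 1 \<or> s = t + 1 \<or> (s = 1 \<and> t = n + 1) \<or> (s = n + 1 \<and> t = 1)"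

definition affine_A_matrix :: "nat \<Rightarrow> nat \<Rightarrow> nat \<Rightarrow> nat" where
  "affine_A_matrix n s t = (if s = t then 1 else if affine_A_adj n s t then 3 else 2)"

definition affine_W :: "nat \<Rightarrow> nat list set monoid" where
  "affine_W n = coxeter_group {1..n + 1} (affine_A_matrix n)"

lemma group_affine_W: "group (affine_W n)"
  unfolding affine_W_def by (rule group_coxeter_group) (simp add: affine_A_matrix_def)

definition sigma_gen :: "nat \<Rightarrow> nat \<Rightarrow> nat list set" where
  "sigma_gen n k = coxeter_gen {1..n + 1} (affine_A_matrix n) k"

definition a_gen :: "nat \<Rightarrow> nat list set" where
  "a_gen n = coxeter_gen {1..n + 1} (affine_A_matrix n) (n + 1)"

definition affine_S :: "nat \<Rightarrow> nat list set set" where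
  "affine_S n = insert (a_gen n) (sigma_gen n ` {1..n})"

definition finite_W :: "nat \<Rightarrow> nat list set set" where
  "finite_W n = generate (affine_W n) (sigma_gen n ` {1..n})"

definition right_desc :: "nat \<Rightarrow> nat list set \<Rightarrow> nat list set set" where
  "right_desc n w = right_descents (affine_W n) (affine_S n) w"

definition affine_length :: "nat \<Rightarrow> nat list set \<Rightarrow> nat" where
  "affine_length n w =
     (LEAST k. \<exists>xs \<in> reduced_expressions (affine_W n) (affine_S n) w. count_list xs (a_gen n) = k)"

text \<open>
  In \<open>ascending\<close> and \<open>descending\<close> the list of indices is empty when \<open>j < i\<close>, respectively
  \<open>i < j\<close>, which gives the conventions for \<open>(n + 1, n)\<close> and \<open>(0, 1)\<close>.
\<close>

definition ascending :: "nat \<Rightarrow> nat \<Rightarrow> nat \<Rightarrow> nat list set" where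
  "ascending n i j = word_prod (affine_W n) (map (sigma_gen n) [i..<Suc j])"

definition descending :: "nat \<Rightarrow> nat \<Rightarrow> nat \<Rightarrow> nat list set" where
  "descending n i j = word_prod (affine_W n) (map (sigma_gen n) (rev [j..<Suc i]))"

definition affine_h :: "nat \<Rightarrow> nat \<Rightarrow> nat \<Rightarrow> nat list set" where
  "affine_h n r i = ascending n r n \<otimes>\<^bsub>affine_W n\<^esub> descending n i 1"

definition affine_B :: "nat \<Rightarrow> nat \<Rightarrow> nat \<Rightarrow> nat list set" where
  "affine_B n r i = affine_h n r i \<otimes>\<^bsub>affine_W n\<^esub> a_gen n"

definition pairwise_inequalities ::
  "nat \<Rightarrow> nat \<Rightarrow> (nat \<Rightarrow> nat) \<Rightarrow> (nat \<Rightarrow> nat) \<Rightarrow> bool" where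
  "pairwise_inequalities n m j i \<longleftrightarrow>
     (1 \<le> j 1 \<and> j 1 \<le> n + 1 \<and> i 1 \<le> n - 1) \<and>
     (\<forall>s\<in>{2..m}. (i s = 0 \<and> j s = 1) \<or> (1 \<le> i s \<and> i s \<le> n - 1 \<and> 1 \<le> j s \<and> j s \<le> n)) \<and>
     (\<forall>s\<in>{2..m}. j s \<le> j (s - 1) \<and> i s \<ge> i (s - 1)) \<and>
     (\<forall>s\<in>{2..m}. j (s - 1) > i (s - 1) + 1 \<longrightarrow> j s < j (s - 1)) \<and>
     (\<forall>s\<in>{2..m}. j s > i s + 1 \<longrightarrow> i s > i (s - 1))"

end

theory Submission
  imports Defs
begin

text \<open>
  Put \<open>N = n + 1\<close> and let the generator \<open>\<sigma>\<^sub>k\<close> act on the integers by exchanging \<open>k + c N\<close> and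
  \<open>k + 1 + c N\<close> for all \<open>c\<close>, with \<open>a\<^sub>n\<^sub>+\<^sub>1\<close> in the role of \<open>k = N\<close>.  This turns
  \<open>W\<close> into a group of \<open>N\<close>-periodic permutations of the integers.  Right descents become visible in
  this action: \<open>l (w s) < l w\<close> exactly if \<open>w\<close> inverts the pair of adjacent integers exchanged by
  \<open>s\<close> (\<open>shorter_iff_descent\<close>).  The proof is the classical one for root systems: an induction on
  the length through the dihedral subgroup generated by two simple reflections.  It uses neither
  faithfulness of the action nor the exchange condition.

  An element \<open>x\<close> of the parabolic subgroup permutes the window \<open>{1..N}\<close>.  Hence, if \<open>u\<close> is
  increasing on the window, then \<open>u x\<close> and \<open>x\<close> invert the same adjacent pairs inside the window, that
  is, they have the same right descents among \<open>\<sigma>\<^sub>1, \<dots>, \<sigma>\<^sub>n\<close>; and \<open>x\<close> does not have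
  \<open>a\<^sub>n\<^sub>+\<^sub>1\<close> as a descent, since it keeps \<open>N\<close> inside the window and \<open>N + 1\<close> above it.

  It remains to see that \<open>u = B (j\<^sub>1, i\<^sub>1) \<dots> B (j\<^sub>m, i\<^sub>m)\<close> is increasing on the window
  (\<open>blocks_sorted\<close>).  Multiplying \<open>f\<close> on the right by \<open>B (r, i)\<close> removes the
  values of \<open>f\<close> at two positions \<open>r\<close> and \<open>q\<close> from the window, puts \<open>f r - N\<close> in front and
  \<open>f q + N\<close> at the end, and keeps the order of the others.  The outcome is
  sorted if \<open>f r - N\<close> is smaller and \<open>f q + N\<close> larger than all values which stay.  For sorted
  \<open>f\<close> these are comparisons with the first and the last value of \<open>f\<close>, which were themselves produced
  by the previous block, and there they become comparisons of positions, which
  follow from the pairwise inequalities.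
\<close>

section \<open>Affine permutations\<close>

abbreviation weq :: "nat \<Rightarrow> nat list \<Rightarrow> nat list \<Rightarrow> bool" where
  "weq n \<equiv> coxeter_eq {1..n + 1} (affine_A_matrix n)"

definition swap :: "nat \<Rightarrow> int \<Rightarrow> int \<Rightarrow> int" where
  "swap n k z = (if int n + 1 dvd z - k then z + 1 else if int n + 1 dvd z - k - 1 then z - 1 else z)"

definition act :: "nat \<Rightarrow> nat list \<Rightarrow> int \<Rightarrow> int" where
  "act n u z = foldr (\<lambda>k. swap n (int k)) u z"

lemma act_Nil [simp]: "act n [] z = z"
  and act_Cons [simp]: "act n (k # u) z = swap n (int k) (act n u z)"
  and act_append [simp]: "act n (u @ v) z = act n u (act n v z)"
  by (simp_all add: act_def)

lemma not_dvd_small: "0 < \<bar>d\<bar> \<Longrightarrow> \<bar>d\<bar> < N \<Longrightarrow> \<not> N dvd (d :: int)"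
  using dvd_imp_le_int[of d N] by auto

lemma swap_shift: "swap n k (z + c * (int n + 1)) = swap n k z + c * (int n + 1)"
proof -
  have "z + c * (int n + 1) - k = (z - k) + (int n + 1) * c"
    "z + c * (int n + 1) - k - 1 = (z - k - 1) + (int n + 1) * c" by (simp_all add: algebra_simps)
  then show ?thesis unfolding swap_def by (simp only: dvd_add_left_iff dvd_triv_left) simp
qed

lemma swap_index_shift: "swap n (k + c * (int n + 1)) z = swap n k z"
proof -
  have "z - (k + c * (int n + 1)) = (z - k) + (int n + 1) * (- c)"
    "z - (k + c * (int n + 1)) - 1 = (z - k - 1) + (int n + 1) * (- c)" by (simp_all add: algebra_simps)
  then show ?thesis unfolding swap_def by (simp only: dvd_add_left_iff dvd_triv_left)
qed

lemma act_shift: "act n u (z + c * (int n + 1)) = act n u z + c * (int n + 1)"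
  by (induction u) (simp_all add: swap_shift)

lemma swap_left [simp]: "swap n k k = k + 1"
  by (simp add: swap_def)

lemma swap_right [simp]: "n \<ge> 1 \<Longrightarrow> swap n k (k + 1) = k"
  by (simp add: swap_def not_dvd_small)

lemma swap_fix: "\<not> int n + 1 dvd z - k \<Longrightarrow> \<not> int n + 1 dvd z - k - 1 \<Longrightarrow> swap n k z = z"
  by (simp add: swap_def)

lemma swap_far:
  assumes "k + 1 < z \<and> z < k + 1 + int n \<or> z < k \<and> k < z + int n"
  shows "swap n k z = z"
  using assms by (intro swap_fix not_dvd_small) auto

text \<open>
  Together with \<open>swap_shift\<close> this reduces identities between swaps to finitely many evaluations.
\<close>

lemma swap_cases:
  obtains c where "z = k + c * (int n + 1)" | c where "z = k + 1 + c * (int n + 1)"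
  | "\<not> int n + 1 dvd z - k" "\<not> int n + 1 dvd z - k - 1"
proof -
  have "\<exists>c. z = k + c * (int n + 1)" if "int n + 1 dvd z - k"
  proof -
    from that obtain c where "z - k = (int n + 1) * c" by (rule dvdE)
    then have "z = k + c * (int n + 1)" by (simp add: algebra_simps)
    then show ?thesis by blast
  qed
  moreover have "\<exists>c. z = k + 1 + c * (int n + 1)" if "int n + 1 dvd z - k - 1"
  proof -
    from that obtain c where "z - k - 1 = (int n + 1) * c" by (rule dvdE)
    then have "z = k + 1 + c * (int n + 1)" by (simp add: algebra_simps)
    then show ?thesis by blast
  qed
  ultimately show ?thesis using that by blast
qed

lemma swap_swap [simp]:
  assumes "n \<ge> 1" shows "swap n k (swap n k z) = z"
  by (rule swap_cases[of z k n]) (use assms in \<open>simp_all add: swap_shift swap_fix\<close>)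

lemma swap_braid:
  assumes n: "n \<ge> 2"
  shows "swap n k (swap n (k + 1) (swap n k z)) = swap n (k + 1) (swap n k (swap n (k + 1) z))"
proof -
  define l where "l = k + 1 + 1"
  have v: "swap n k k = k + 1" "swap n k (k + 1) = k" "swap n k l = l"
    "swap n (k + 1) k = k" "swap n (k + 1) (k + 1) = l" "swap n (k + 1) l = k + 1"
    unfolding l_def using n swap_right[of n "k + 1"] by (simp_all add: swap_far)
  show ?thesis
  proof (cases rule: swap_cases[of z k n])
    case 3
    note z = 3
    show ?thesis
    proof (cases rule: swap_cases[of z "k + 1" n])
      case (1 c)
      then show ?thesis by (simp add: swap_shift v del: swap_left swap_right)
    next
      case (2 c)
      then have "z = l + c * (int n + 1)" by (simp add: l_def)
      then show ?thesis by (simp add: swap_shift v del: swap_left swap_right)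
    next
      case 3
      with z show ?thesis by (simp add: swap_fix)
    qed
  qed (simp_all add: swap_shift v del: swap_left swap_right)
qed

lemma swap_commute:
  assumes n: "n \<ge> 1" and st: "\<not> int n + 1 dvd s - t" "\<not> int n + 1 dvd s - t - 1" "\<not> int n + 1 dvd s - t + 1"
  shows "swap n s (swap n t z) = swap n t (swap n s z)"
proof -
  have ts: "\<not> int n + 1 dvd t - s" "\<not> int n + 1 dvd t - s - 1" "\<not> int n + 1 dvd t - s + 1"
    using st dvd_minus_iff[of "int n + 1" "s - t"] dvd_minus_iff[of "int n + 1" "s - t + 1"]
      dvd_minus_iff[of "int n + 1" "s - t - 1"] by (simp_all add: algebra_simps)
  have v: "swap n s t = t" "swap n s (t + 1) = t + 1" "swap n t s = s" "swap n t (s + 1) = s + 1"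
    using st ts by (simp_all add: swap_def add.commute add_diff_eq diff_add_eq)
  show ?thesis
  proof (cases rule: swap_cases[of z s n])
    case 3
    then show ?thesis
      by (cases rule: swap_cases[of z t n]) (use n in \<open>simp_all add: swap_shift v swap_fix\<close>)
  qed (use n in \<open>simp_all add: swap_shift v\<close>)
qed

text \<open>
  On the cycle the neighbours \<open>1\<close> and \<open>n + 1\<close> are not consecutive integers, but they become so after
  translating one of them by a period.  This allows every adjacent pair to be treated as consecutive.
\<close>

lemma adj_shift:
  assumes "affine_A_adj n s t"
  obtains c where "int t + c * (int n + 1) = int s + 1" | c where "int t + c * (int n + 1) = int s - 1"
proof -
  from assms consider "t = s + 1" | "s = t + 1" | "s = 1" "t = n + 1" | "s = n + 1" "t = 1"
    unfolding affine_A_adj_def by blast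
  then show ?thesis
  proof cases
    case 1 then show ?thesis using that(1)[of 0] by simp
  next
    case 2 then show ?thesis using that(2)[of 0] by simp
  next
    case 3 then show ?thesis using that(2)[of "-1"] by simp
  next
    case 4 then show ?thesis using that(1)[of 1] by simp
  qed
qed

lemma swap_braid_adj:
  assumes n: "n \<ge> 2" and adj: "affine_A_adj n s t"
  shows "swap n (int s) (swap n (int t) (swap n (int s) z)) = swap n (int t) (swap n (int s) (swap n (int t) z))"
  using adj
proof (cases rule: adj_shift)
  case (1 c)
  have "swap n (int t) = swap n (int s + 1)" using swap_index_shift[of n "int t" c] 1 by (simp add: fun_eq_iff)
  then show ?thesis using swap_braid[OF n] by simp
next
  case (2 c)
  have "swap n (int t) = swap n (int s - 1)" using swap_index_shift[of n "int t" c] 2 by (simp add: fun_eq_iff)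
  then show ?thesis using swap_braid[OF n, of "int s - 1"] by simp
qed

lemma nonadj_not_dvd:
  assumes "s \<in> {1..n+1}" "t \<in> {1..n+1}" "s \<noteq> t" "\<not> affine_A_adj n s t" "n \<ge> 2"
  shows "\<not> int n + 1 dvd int s - int t" "\<not> int n + 1 dvd int s - int t - 1"
    "\<not> int n + 1 dvd int s - int t + 1"
  by (rule not_dvd_small; use assms in \<open>simp add: affine_A_adj_def; linarith\<close>)+

lemma swap_commute_nonadj:
  assumes n: "n \<ge> 2" and st: "s \<in> {1..n+1}" "t \<in> {1..n+1}" "s \<noteq> t" "\<not> affine_A_adj n s t"
  shows "swap n (int s) (swap n (int t) z) = swap n (int t) (swap n (int s) z)"
  using nonadj_not_dvd[OF st n] n by (intro swap_commute) auto

lemma act_relation: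
  assumes n: "n \<ge> 2" and st: "s \<in> {1..n+1}" "t \<in> {1..n+1}"
  shows "act n (concat (replicate (affine_A_matrix n s t) [s, t])) z = z"
proof -
  consider "s = t" | "s \<noteq> t" "affine_A_adj n s t" | "s \<noteq> t" "\<not> affine_A_adj n s t" by blast
  then show ?thesis
  proof cases
    case 1
    then show ?thesis using n by (simp add: affine_A_matrix_def)
  next
    case 2
    then show ?thesis using n swap_braid_adj[OF n 2(2)]
      by (simp add: affine_A_matrix_def numeral_3_eq_3)
  next
    case 3
    then show ?thesis using n swap_commute_nonadj[OF n st 3]
      by (simp add: affine_A_matrix_def numeral_2_eq_2)
  qed
qed

lemma act_weq:
  assumes "weq n u v" and n: "n \<ge> 2"
  shows "act n u = act n v"
  using assms(1)
proof induction
  case (relation u v s t)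
  then show ?case using act_relation[OF n] by (simp add: fun_eq_iff)
qed simp_all

section \<open>Length of words modulo the relations\<close>

definition wlen :: "nat \<Rightarrow> nat list \<Rightarrow> nat" where
  "wlen n u = (LEAST k. \<exists>v. weq n u v \<and> length v = k)"

lemma wlen_le: "weq n u v \<Longrightarrow> wlen n u \<le> length v"
  unfolding wlen_def by (rule Least_le) blast

lemma wlen_attained:
  assumes "u \<in> lists {1..n+1}"
  obtains v where "weq n u v" "length v = wlen n u"
proof -
  have "\<exists>v. weq n u v \<and> length v = wlen n u"
    unfolding wlen_def by (rule LeastI_ex) (use coxeter_eq.refl[OF assms] in blast)
  then show ?thesis using that by blast
qed

lemma wlen_cong: "weq n u v \<Longrightarrow> wlen n u = wlen n v"
proof -
  assume "weq n u v"
  then have "weq n u x \<longleftrightarrow> weq n v x" for x by (meson coxeter_eq.sym coxeter_eq.trans)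
  then show ?thesis by (simp add: wlen_def)
qed

text \<open>
  All relators have even length, so lengths have a well-defined parity; this excludes
  \<open>l (w s) = l w\<close>.
\<close>

lemma parity_weq: "weq n u v \<Longrightarrow> even (length u) \<longleftrightarrow> even (length v)"
  by (induction rule: coxeter_eq.induct) (auto simp: length_concat sum_list_replicate)

lemma wlen_parity: "u \<in> lists {1..n+1} \<Longrightarrow> even (wlen n u) \<longleftrightarrow> even (length u)"
  by (metis parity_weq wlen_attained)

lemma wlen_snoc_le:
  assumes "u \<in> lists {1..n+1}" "s \<in> {1..n+1}"
  shows "wlen n (u @ [s]) \<le> wlen n u + 1"
proof -
  obtain v where v: "weq n u v" "length v = wlen n u" using wlen_attained[OF assms(1)] .
  then have "weq n (u @ [s]) (v @ [s])" using assms by (intro coxeter_eq_append_right) auto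
  from wlen_le[OF this] v show ?thesis by simp
qed

lemma weq_square:
  assumes "u \<in> lists {1..n+1}" "s \<in> {1..n+1}"
  shows "weq n (u @ [s, s]) u"
  using coxeter_eq.relation[of u "{1..n+1}" "[]" s s "affine_A_matrix n"] assms
  by (simp add: affine_A_matrix_def)

lemma wlen_snoc:
  assumes "u \<in> lists {1..n+1}" "s \<in> {1..n+1}"
  shows "wlen n (u @ [s]) = wlen n u + 1 \<or> wlen n u = wlen n (u @ [s]) + 1"
proof -
  have "wlen n u \<le> wlen n (u @ [s]) + 1"
    using wlen_snoc_le[of "u @ [s]" n s] wlen_cong[OF weq_square[OF assms]] assms by simp
  moreover have "wlen n u \<noteq> wlen n (u @ [s])"
    using wlen_parity[of u n] wlen_parity[of "u @ [s]" n] assms by auto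
  ultimately show ?thesis using wlen_snoc_le[OF assms] by linarith
qed

lemma weq_cancel_right:
  assumes "weq n (u @ [s]) v" "u \<in> lists {1..n+1}" "s \<in> {1..n+1}"
  shows "weq n u (v @ [s])"
  using coxeter_eq_append_right[OF assms(1), of "[s]"] weq_square[OF assms(2,3)] assms
  by simp (meson coxeter_eq.sym coxeter_eq.trans)

lemma weq_commute:
  assumes "u \<in> lists {1..n+1}" "s \<in> {1..n+1}" "t \<in> {1..n+1}" "s \<noteq> t" "\<not> affine_A_adj n s t"
  shows "weq n (u @ [s, t]) (u @ [t, s])"
proof -
  have "weq n (u @ [s, t, s, t]) u"
    using coxeter_eq.relation[of u "{1..n+1}" "[]" s t "affine_A_matrix n"] assms
    by (simp add: affine_A_matrix_def numeral_2_eq_2)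
  then have "weq n (u @ [s, t, s]) (u @ [t])"
    using weq_cancel_right[of n "u @ [s, t, s]" t u] assms by simp
  then show ?thesis
    using weq_cancel_right[of n "u @ [s, t]" s "u @ [t]"] assms by simp
qed

lemma weq_braid:
  assumes "u \<in> lists {1..n+1}" "s \<in> {1..n+1}" "t \<in> {1..n+1}" "s \<noteq> t" "affine_A_adj n s t"
  shows "weq n (u @ [s, t, s]) (u @ [t, s, t])"
proof -
  have "weq n (u @ [s, t, s, t, s, t]) u"
    using coxeter_eq.relation[of u "{1..n+1}" "[]" s t "affine_A_matrix n"] assms
    by (simp add: affine_A_matrix_def numeral_3_eq_3)
  then have "weq n (u @ [s, t, s, t, s]) (u @ [t])"
    using weq_cancel_right[of n "u @ [s, t, s, t, s]" t u] assms by simp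
  then have "weq n (u @ [s, t, s, t]) (u @ [t, s])"
    using weq_cancel_right[of n "u @ [s, t, s, t]" s "u @ [t]"] assms by simp
  then show ?thesis
    using weq_cancel_right[of n "u @ [s, t, s]" t "u @ [t, s]"] assms by simp
qed

section \<open>Descents are inversions of adjacent integers\<close>

lemma act_ascent_shift:
  assumes "int t + c * (int n + 1) = k"
  shows "act n u (int t) < act n u (int t + 1) \<longleftrightarrow> act n u k < act n u (k + 1)"
  using act_shift[of n u "int t" c] act_shift[of n u "int t + 1" c] assms
  by (simp add: algebra_simps)

text \<open>
  The induction of the theory of root systems, with the pair \<open>s, s + 1\<close> in the role of the simple
  root of \<open>s\<close>.  Let \<open>t\<close> be the last letter of a reduced word of \<open>w\<close>.  Then \<open>t \<noteq> s\<close>, and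
  stripping from the end of \<open>w\<close> the letters \<open>s\<close> and \<open>t\<close> as long as this shortens it leaves an element to
  which the induction hypothesis applies for both \<open>s\<close> and \<open>t\<close>, as further shortening would
  contradict \<open>l (w s) > l w\<close>.  If \<open>s\<close> and \<open>t\<close> are adjacent, this element is increasing on three
  consecutive integers, and the stripped letters permute these without inverting \<open>s, s + 1\<close>.
\<close>

lemma ascent_if_longer:
  assumes n: "n \<ge> 2" and "u \<in> lists {1..n+1}" "s \<in> {1..n+1}" "wlen n (u @ [s]) > wlen n u"
  shows "act n u (int s) < act n u (int s + 1)"
  using assms(2-4)
proof (induction "wlen n u" arbitrary: u s rule: less_induct)
  case (less w s)
  note s = \<open>s \<in> {1..n+1}\<close>
  obtain v where v: "weq n w v" "length v = wlen n w" using wlen_attained[OF less.prems(1)] .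
  have actwv: "act n w = act n v" using act_weq[OF v(1) n] .
  have lv: "wlen n v = wlen n w" using wlen_cong[OF v(1)] by simp
  have vl: "v \<in> lists {1..n+1}" using coxeter_eq_lists[OF v(1)] by blast
  have longer: "wlen n (v @ [s]) > wlen n v"
    using wlen_cong[OF coxeter_eq_append_right[OF v(1), of "[s]"]] s lv less.prems(3) by simp
  show ?case
  proof (cases v rule: rev_cases)
    case Nil
    then show ?thesis by (simp add: actwv)
  next
    case (snoc x t)
    have x: "x \<in> lists {1..n+1}" and t: "t \<in> {1..n+1}" using vl snoc by auto
    have lx: "wlen n v = wlen n x + 1"
      using wlen_le[OF coxeter_eq.refl[OF x]] wlen_snoc[OF x t] v(2) lv snoc by auto
    have st: "s \<noteq> t"
      using longer wlen_cong[OF weq_square[OF x t]] lx snoc by auto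
    have asc_t: "act n x (int t) < act n x (int t + 1)"
      using less.hyps[of x t] lx lv x t snoc by simp
    show ?thesis
    proof (cases "affine_A_adj n s t")
      case False
      \<comment> \<open>\<open>s\<close> and \<open>t\<close> commute, and \<open>t\<close> fixes \<open>s\<close> and \<open>s + 1\<close>.\<close>
      have "wlen n (x @ [s]) > wlen n x"
      proof (rule ccontr)
        assume "\<not> ?thesis"
        then have "wlen n x = wlen n (x @ [s]) + 1" using wlen_snoc[OF x s] by linarith
        moreover have "wlen n (v @ [s]) = wlen n (x @ [s, t])"
          using wlen_cong[OF weq_commute[OF x s t st False]] snoc by simp
        moreover have "wlen n (x @ [s, t]) \<le> wlen n (x @ [s]) + 1"
          using wlen_snoc_le[of "x @ [s]" n t] x s t by simp
        ultimately show False using longer lx by linarith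
      qed
      then have "act n x (int s) < act n x (int s + 1)" using less.hyps[of x s] lx lv x s by simp
      moreover have "swap n (int t) (int s) = int s" "swap n (int t) (int s + 1) = int s + 1"
        using nonadj_not_dvd[OF s t st False n]
        by (simp_all add: swap_def algebra_simps)
      ultimately show ?thesis by (simp add: actwv snoc)
    next
      case adj: True
      show ?thesis
      proof (cases "wlen n (x @ [s]) > wlen n x")
        case True
        then have asc_s: "act n x (int s) < act n x (int s + 1)" using less.hyps[of x s] lx lv x s by simp
        show ?thesis using adj
        proof (cases rule: adj_shift)
          case (1 c)
          have "swap n (int t) = swap n (int s + 1)"
            using swap_index_shift[of n "int t" c] 1 by (simp add: fun_eq_iff)
          moreover have "act n x (int s + 1) < act n x (int s + 2)"
            using asc_t act_ascent_shift[OF 1] by (simp add: add.assoc)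
          ultimately show ?thesis using asc_s n
            by (simp add: actwv snoc swap_far add.assoc)
        next
          case (2 c)
          have "swap n (int t) = swap n (int s - 1)"
            using swap_index_shift[of n "int t" c] 2 by (simp add: fun_eq_iff)
          moreover have "act n x (int s - 1) < act n x (int s)"
            using asc_t act_ascent_shift[OF 2] by simp
          ultimately show ?thesis using asc_s n swap_right[of n "int s - 1"]
            by (simp add: actwv snoc swap_far)
        qed
      next
        case False
        \<comment> \<open>Now \<open>x = y s\<close> and \<open>w = y s t\<close>; by the braid relation, a descent \<open>t\<close> of \<open>y\<close> would make
          \<open>w s = y t s t\<close> shorter than \<open>w\<close>.\<close>
        obtain y where y: "weq n (x @ [s]) y" "length y = wlen n (x @ [s])"
          using wlen_attained[of "x @ [s]" n] x s by auto
        have yl: "y \<in> lists {1..n+1}" using coxeter_eq_lists[OF y(1)] by blast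
        have ly: "wlen n x = wlen n y + 1"
          using False wlen_snoc[OF x s] wlen_cong[OF y(1)] by linarith
        have xy: "weq n x (y @ [s])" using weq_cancel_right[OF y(1) x s] .
        have asc_s: "act n y (int s) < act n y (int s + 1)"
          using less.hyps[of y s] yl s ly lx lv wlen_cong[OF xy] by simp
        have "wlen n (y @ [t]) > wlen n y"
        proof (rule ccontr)
          assume "\<not> ?thesis"
          then have "wlen n y = wlen n (y @ [t]) + 1" using wlen_snoc[OF yl t] by linarith
          moreover have "weq n (x @ [t, s]) (y @ [s, t, s])"
            using coxeter_eq_append_right[OF xy, of "[t, s]"] s t by simp
          then have "wlen n (v @ [s]) = wlen n (y @ [t, s, t])"
            using wlen_cong[OF weq_braid[OF yl s t st adj]] wlen_cong snoc by simp
          moreover have "wlen n (y @ [t, s, t]) \<le> wlen n (y @ [t, s]) + 1"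
            using wlen_snoc_le[of "y @ [t, s]" n t] yl s t by simp
          moreover have "wlen n (y @ [t, s]) \<le> wlen n (y @ [t]) + 1"
            using wlen_snoc_le[of "y @ [t]" n s] yl s t by simp
          ultimately show False using longer lx ly by linarith
        qed
        then have asc_t: "act n y (int t) < act n y (int t + 1)"
          using less.hyps[of y t] yl t ly lx lv by simp
        have actx: "act n x z = act n y (swap n (int s) z)" for z
          using act_weq[OF xy n] by simp
        show ?thesis using adj
        proof (cases rule: adj_shift)
          case (1 c)
          have "swap n (int t) = swap n (int s + 1)"
            using swap_index_shift[of n "int t" c] 1 by (simp add: fun_eq_iff)
          moreover have "act n y (int s + 1) < act n y (int s + 2)"
            using asc_t act_ascent_shift[OF 1] by (simp add: add.assoc)
          ultimately show ?thesis using n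
            by (simp add: actwv snoc actx swap_far add.assoc)
        next
          case (2 c)
          have "swap n (int t) = swap n (int s - 1)"
            using swap_index_shift[of n "int t" c] 2 by (simp add: fun_eq_iff)
          moreover have "act n y (int s - 1) < act n y (int s)"
            using asc_t act_ascent_shift[OF 2] by simp
          ultimately show ?thesis using n swap_right[of n "int s - 1"]
            by (simp add: actwv snoc actx swap_far)
        qed
      qed
    qed
  qed
qed

lemma shorter_iff_descent:
  assumes n: "n \<ge> 2" and u: "u \<in> lists {1..n+1}" and s: "s \<in> {1..n+1}"
  shows "wlen n (u @ [s]) < wlen n u \<longleftrightarrow> act n u (int s + 1) < act n u (int s)"
proof (cases "wlen n (u @ [s]) < wlen n u")
  case True
  then have "wlen n ((u @ [s]) @ [s]) > wlen n (u @ [s])"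
    using wlen_cong[OF weq_square[OF u s]] by simp
  then have "act n (u @ [s]) (int s) < act n (u @ [s]) (int s + 1)"
    using ascent_if_longer[OF n, of "u @ [s]" s] u s by simp
  then show ?thesis using True n by simp
next
  case False
  then show ?thesis using ascent_if_longer[OF n u s] wlen_snoc[OF u s] by linarith
qed

section \<open>Passage to the group\<close>

definition cls :: "nat \<Rightarrow> nat list \<Rightarrow> nat list set" where
  "cls n u = coxeter_rel {1..n+1} (affine_A_matrix n) `` {u}"

lemma cls_eq_iff:
  "u \<in> lists {1..n+1} \<Longrightarrow> v \<in> lists {1..n+1} \<Longrightarrow> cls n u = cls n v \<longleftrightarrow> weq n u v"
  unfolding cls_def using eq_equiv_class_iff[OF equiv_coxeter_rel]
  by (metis (mono_tags, lifting) coxeter_rel_def mem_Collect_eq case_prod_conv)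

lemma cls_mult:
  "u \<in> lists {1..n+1} \<Longrightarrow> v \<in> lists {1..n+1} \<Longrightarrow> cls n u \<otimes>\<^bsub>affine_W n\<^esub> cls n v = cls n (u @ v)"
  by (simp add: cls_def affine_W_def coxeter_mult_class)

lemma cls_one: "\<one>\<^bsub>affine_W n\<^esub> = cls n []"
  by (simp add: cls_def affine_W_def coxeter_group_def)

lemma cls_carrier: "u \<in> lists {1..n+1} \<Longrightarrow> cls n u \<in> carrier (affine_W n)"
  by (auto simp: cls_def affine_W_def coxeter_group_def quotient_def)

lemma sigma_gen_cls: "sigma_gen n k = cls n [k]"
  and a_gen_cls: "a_gen n = cls n [n + 1]"
  by (simp_all add: cls_def sigma_gen_def a_gen_def coxeter_gen_def)

lemma affine_S_cls: "affine_S n = (\<lambda>k. cls n [k]) ` {1..n+1}"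
proof -
  have "{1..n+1} = insert (n+1) {1..n}" by auto
  then show ?thesis by (simp add: affine_S_def sigma_gen_cls a_gen_cls)
qed

lemma concat_in_lists: "(\<And>u. u \<in> set us \<Longrightarrow> u \<in> lists A) \<Longrightarrow> concat us \<in> lists A"
  by (induction us) auto

lemma word_prod_cls:
  assumes "\<And>y. y \<in> set ys \<Longrightarrow> f y \<in> lists {1..n+1}"
  shows "word_prod (affine_W n) (map (\<lambda>y. cls n (f y)) ys) = cls n (concat (map f ys))"
  using assms
proof (induction ys)
  case Nil
  then show ?case by (simp add: word_prod_def cls_one)
next
  case (Cons y ys)
  have "concat (map f ys) \<in> lists {1..n+1}" using Cons.prems by (intro concat_in_lists) auto
  then show ?case using Cons cls_mult[of "f y" n "concat (map f ys)"] by (simp add: word_prod_def)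
qed

lemma coxeter_length_cls:
  assumes u: "u \<in> lists {1..n+1}"
  shows "coxeter_length (affine_W n) (affine_S n) (cls n u) = wlen n u"
proof -
  have "(\<exists>xs\<in>lists (affine_S n). word_prod (affine_W n) xs = cls n u \<and> length xs = k)
      \<longleftrightarrow> (\<exists>v. weq n u v \<and> length v = k)" (is "?L \<longleftrightarrow> ?R") for k
  proof
    assume ?L
    then obtain v where v: "v \<in> lists {1..n+1}" "length v = k"
      "word_prod (affine_W n) (map (\<lambda>k. cls n [k]) v) = cls n u"
      unfolding affine_S_cls lists_image by auto
    then have "cls n v = cls n u" using word_prod_cls[of v "\<lambda>k. [k]" n] by auto
    then show ?R using cls_eq_iff[OF v(1) u] v(2) coxeter_eq.sym by blast
  next
    assume ?R
    then obtain v where v: "weq n u v" "length v = k" by blast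
    then have vl: "v \<in> lists {1..n+1}" using coxeter_eq_lists by blast
    then have "word_prod (affine_W n) (map (\<lambda>k. cls n [k]) v) = cls n u"
      using word_prod_cls[of v "\<lambda>k. [k]" n] cls_eq_iff[OF u vl] v by auto
    moreover have "map (\<lambda>k. cls n [k]) v \<in> lists (affine_S n)" using vl unfolding affine_S_cls lists_image by blast
    ultimately show ?L using v(2) by (intro bexI[of _ "map (\<lambda>k. cls n [k]) v"]) auto
  qed
  then show ?thesis by (simp add: coxeter_length_def wlen_def)
qed

lemma right_desc_cls:
  assumes n: "n \<ge> 2" and u: "u \<in> lists {1..n+1}"
  shows "right_desc n (cls n u) = (\<lambda>k. cls n [k]) ` {k \<in> {1..n+1}. act n u (int k + 1) < act n u (int k)}"
proof -
  have "coxeter_length (affine_W n) (affine_S n) (cls n u \<otimes>\<^bsub>affine_W n\<^esub> cls n [k])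
      < coxeter_length (affine_W n) (affine_S n) (cls n u)
    \<longleftrightarrow> act n u (int k + 1) < act n u (int k)" if "k \<in> {1..n+1}" for k
    using that u cls_mult[of u n "[k]"] shorter_iff_descent[OF n u that] by (simp add: coxeter_length_cls)
  then show ?thesis unfolding right_desc_def right_descents_def affine_S_cls by auto
qed

lemma finite_W_word:
  assumes "x \<in> finite_W n"
  obtains v where "v \<in> lists {1..n}" "x = cls n v"
proof -
  interpret group "affine_W n" by (rule group_affine_W)
  have "\<exists>v\<in>lists {1..n}. x = cls n v"
    using assms unfolding finite_W_def
  proof (induction rule: generate.induct)
    case one
    then show ?case by (auto simp: cls_one)
  next
    case (incl h)
    then show ?case by (auto simp: sigma_gen_cls intro!: bexI[of _ "[_]"])
  next
    case (inv h)
    then obtain k where k: "k \<in> {1..n}" "h = cls n [k]" by (auto simp: sigma_gen_cls)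
    have "cls n [k] \<otimes>\<^bsub>affine_W n\<^esub> cls n [k] = \<one>\<^bsub>affine_W n\<^esub>"
      using k weq_square[of "[]" n k] cls_mult[of "[k]" n "[k]"] cls_eq_iff[of "[k, k]" n "[]"] by (simp add: cls_one)
    then have "inv\<^bsub>affine_W n\<^esub> h = h"
      using k cls_carrier[of "[k]" n] by (intro inv_equality) auto
    then show ?case using k by (auto intro!: bexI[of _ "[k]"])
  next
    case (eng h1 h2)
    then obtain v1 v2 where v: "v1 \<in> lists {1..n}" "h1 = cls n v1" "v2 \<in> lists {1..n}" "h2 = cls n v2" by blast
    then have "v1 \<in> lists {1..n+1}" "v2 \<in> lists {1..n+1}" by auto
    with v show ?case by (intro bexI[of _ "v1 @ v2"]) (auto simp: cls_mult)
  qed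
  then show ?thesis using that by blast
qed

lemma act_finite_range:
  assumes n: "n \<ge> 2" and "v \<in> lists {1..n}" "z \<in> {1..int n + 1}"
  shows "act n v z \<in> {1..int n + 1}"
  using assms(2)
proof (induction v)
  case Nil
  then show ?case using assms(3) by simp
next
  case (Cons k v)
  define y where "y = act n v z"
  have y: "1 \<le> y" "y \<le> int n + 1" and k: "1 \<le> k" "k \<le> n" using Cons by (auto simp: y_def)
  consider "y = int k" | "y = int k + 1" | "y > int k + 1" | "y < int k" by linarith
  then have "swap n (int k) y \<in> {1..int n + 1}"
    by cases (use y k n in \<open>auto simp: swap_far\<close>)
  then show ?case by (simp add: y_def)
qed

section \<open>The window of a product of blocks\<close>

definition block :: "nat \<Rightarrow> nat \<Rightarrow> nat \<Rightarrow> nat list" where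
  "block n r i = [r..<Suc n] @ rev [1..<Suc i] @ [n + 1]"

lemma block_lists: "1 \<le> r \<Longrightarrow> i \<le> n \<Longrightarrow> block n r i \<in> lists {1..n+1}"
  by (auto simp: block_def in_lists_conv_set)

lemma affine_B_block:
  assumes "1 \<le> r" "i \<le> n"
  shows "affine_B n r i = cls n (block n r i)"
proof -
  have 1: "[r..<Suc n] \<in> lists {1..n+1}" "rev [1..<Suc i] \<in> lists {1..n+1}"
    using assms by (auto simp: in_lists_conv_set)
  have 2: "word_prod (affine_W n) (map (sigma_gen n) u) = cls n u" if "u \<in> lists {1..n+1}" for u
    using word_prod_cls[of u "\<lambda>k. [k]" n] that by (auto simp: sigma_gen_cls[abs_def])
  show ?thesis unfolding affine_B_def affine_h_def ascending_def descending_def 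
    2[OF 1(1)] 2[OF 1(2)] a_gen_cls block_def
    using 1 by (simp add: cls_mult del: upt_Suc)
qed

lemma act_ascending:
  assumes n: "n \<ge> 2" and "1 \<le> r" "r \<le> n + 1" "1 \<le> z" "z \<le> int n + 1"
  shows "act n [r..<Suc n] z = (if z = int n + 1 then int r else if int r \<le> z then z + 1 else z)"
  using assms(2,3)
proof (induction "n + 1 - r" arbitrary: r)
  case 0
  then show ?case using assms by auto
next
  case (Suc d)
  then have r: "r \<le> n" by linarith
  have IH: "act n [Suc r..<Suc n] z
      = (if z = int n + 1 then int (Suc r) else if int (Suc r) \<le> z then z + 1 else z)"
    using Suc.hyps(1)[of "Suc r"] Suc.hyps(2) Suc.prems r by linarith
  have "[r..<Suc n] = r # [Suc r..<Suc n]" using r by (simp add: upt_rec)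
  then have *: "act n [r..<Suc n] z = swap n (int r) (act n [Suc r..<Suc n] z)" by simp
  consider "z = int n + 1" | "z \<le> int n" "int r + 1 \<le> z" | "z = int r" | "z < int r"
    using assms by linarith
  then show ?case
    unfolding * IH
    by cases (use n r Suc.prems assms(4,5) swap_right[of n "int r"] in \<open>auto simp: swap_far add.commute\<close>)
qed

lemma act_descending:
  assumes n: "n \<ge> 2" and "i < n" "1 \<le> z" "z \<le> int n + 1"
  shows "act n (rev [1..<Suc i]) z = (if z = 1 then int i + 1 else if z \<le> int i + 1 then z - 1 else z)"
  using assms(2)
proof (induction i)
  case 0
  then show ?case using assms by auto
next
  case (Suc i)
  have *: "act n (rev [1..<Suc (Suc i)]) z = swap n (int i + 1) (act n (rev [1..<Suc i]) z)"
    by (simp add: add.commute)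
  have IH: "act n (rev [1..<Suc i]) z = (if z = 1 then int i + 1 else if z \<le> int i + 1 then z - 1 else z)"
    using Suc by simp
  consider "z = 1" | "z \<noteq> 1" "z \<le> int i + 1" | "z = int i + 2" | "z > int i + 2" by linarith
  then show ?case
    unfolding * IH
    by cases (use n Suc.prems assms(3,4) swap_right[of n "int i + 1"] in \<open>auto simp: swap_far add.commute\<close>)
qed

text \<open>
  Write \<open>h\<close> for \<open>h (r, i)\<close>.  Then \<open>h N = r\<close>, \<open>h 1\<close> is \<open>top_pos r i\<close>, and \<open>h\<close> maps
  \<open>{2..n}\<close> increasingly, by \<open>mid_pos r i\<close>, onto the remaining positions of the window.
  The final letter of the block exchanges the roles of \<open>1\<close> and \<open>N\<close> up to a period.
\<close>

definition top_pos :: "nat \<Rightarrow> nat \<Rightarrow> int" where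
  "top_pos r i = (if r \<le> i + 1 then int i + 2 else int i + 1)"

definition mid_pos :: "nat \<Rightarrow> nat \<Rightarrow> int \<Rightarrow> int" where
  "mid_pos r i z = (let y = (if z \<le> int i + 1 then z - 1 else z) in if int r \<le> y then y + 1 else y)"

lemma act_block:
  assumes n: "n \<ge> 2" and r: "1 \<le> r" "r \<le> n + 1" and i: "i < n"
  shows "act n (block n r i) 1 = int r - (int n + 1)"
    and "act n (block n r i) (int n + 1) = top_pos r i + (int n + 1)"
    and "2 \<le> z \<Longrightarrow> z \<le> int n \<Longrightarrow> act n (block n r i) z = mid_pos r i z"
proof -
  let ?N = "int n + 1"
  let ?h = "\<lambda>z. act n [r..<Suc n] (act n (rev [1..<Suc i]) z)"
  have B: "act n (block n r i) z = ?h (swap n ?N z)" for z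
    by (simp add: block_def add.commute del: upt_Suc)
  have h1: "?h 1 = top_pos r i"
    using i by (subst act_descending[OF n i]) (auto simp: act_ascending[OF n r] top_pos_def simp del: upt_Suc)
  have hN: "?h ?N = int r"
    using i by (subst act_descending[OF n i]) (auto simp: act_ascending[OF n r] simp del: upt_Suc)
  have "swap n ?N 1 = swap n 0 1" using swap_index_shift[of n 0 1] by simp
  then have s1: "swap n ?N 1 = ?N + (- 1) * ?N" using n swap_right[of n 0] by simp
  show "act n (block n r i) 1 = int r - ?N"
    unfolding B s1 act_shift hN by simp
  have sN: "swap n ?N ?N = 1 + 1 * ?N" by simp
  show "act n (block n r i) ?N = top_pos r i + ?N"
    unfolding B sN act_shift h1 by simp
  assume z: "2 \<le> z" "z \<le> int n"
  have "swap n ?N z = z" using z n by (intro swap_far) auto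
  then show "act n (block n r i) z = mid_pos r i z"
    unfolding B using z i
    by (subst act_descending[OF n i]) (auto simp: act_ascending[OF n r] mid_pos_def simp del: upt_Suc)
qed

lemma mid_pos_range:
  assumes "1 \<le> r" "r \<le> n + 1" "i < n" "2 \<le> z" "z \<le> int n"
  shows "mid_pos r i z \<in> {1..int n + 1} - {int r, top_pos r i}"
  using assms by (auto simp: mid_pos_def top_pos_def Let_def)

lemma mid_pos_strict_mono: "y < z \<Longrightarrow> mid_pos r i y < mid_pos r i z"
  by (auto simp: mid_pos_def Let_def)

text \<open>
  The passage from \<open>f\<close> to \<open>g\<close> is that from \<open>f\<close> to \<open>f B (r, i)\<close>, where \<open>p = r\<close> and
  \<open>q = top_pos r i\<close>.
\<close>

lemma window_sorted_step:
  fixes f g :: "int \<Rightarrow> int" and N p q :: int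
  assumes N: "N \<ge> 3" and g1: "g 1 = f p - N" and gN: "g N = f q + N"
    and mid: "\<And>z. 2 \<le> z \<Longrightarrow> z < N \<Longrightarrow> \<exists>y\<in>{1..N} - {p, q}. g z = f y"
    and mono: "\<And>y z. 2 \<le> y \<Longrightarrow> y < z \<Longrightarrow> z < N \<Longrightarrow> g y < g z"
    and low: "\<And>y. y \<in> {1..N} - {p} \<Longrightarrow> f p - N < f y"
    and high: "\<And>y. y \<in> {1..N} - {q} \<Longrightarrow> f y < f q + N"
    and pq: "p \<noteq> q" "p \<in> {1..N}"
  shows "strict_mono_on {1..N} g"
proof (rule strict_mono_onI)
  fix y z assume yz: "y \<in> {1..N}" "z \<in> {1..N}" "y < z"
  have pq': "f p - N < f q + N" using high[of p] pq N by simp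
  consider "y = 1" "z = N" | "y = 1" "2 \<le> z" "z < N" | "2 \<le> y" "z = N" | "2 \<le> y" "z < N"
    using yz by fastforce
  then show "g y < g z"
  proof cases
    case 1
    then show ?thesis using pq' g1 gN by simp
  next
    case 2
    obtain x where "x \<in> {1..N} - {p, q}" "g z = f x" using mid[of z] 2 by blast
    then show ?thesis using low[of x] g1 2 by simp
  next
    case 3
    obtain x where "x \<in> {1..N} - {p, q}" "g y = f x" using mid[of y] 3 yz by (metis atLeastAtMost_iff order_le_less)
    then show ?thesis using high[of x] gN 3 by simp
  next
    case 4
    then show ?thesis using mono yz by simp
  qed
qed

definition blocks :: "nat \<Rightarrow> (nat \<Rightarrow> nat) \<Rightarrow> (nat \<Rightarrow> nat) \<Rightarrow> nat \<Rightarrow> nat list" where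
  "blocks n j i m = concat (map (\<lambda>s. block n (j s) (i s)) [1..<Suc m])"

lemma blocks_Suc: "blocks n j i (Suc m) = blocks n j i m @ block n (j (Suc m)) (i (Suc m))"
  by (simp add: blocks_def)

lemma top_pos_range: "i < n \<Longrightarrow> 1 \<le> top_pos r i" "i < n \<Longrightarrow> top_pos r i \<le> int n + 1" "top_pos r i \<noteq> int r"
  by (auto simp: top_pos_def)

lemma sorted_append_block:
  fixes f :: "int \<Rightarrow> int"
  assumes n: "n \<ge> 2" and r: "1 \<le> r" "r \<le> n + 1" and i: "i < n"
    and f: "f = act n u"
    and low: "\<And>y. y \<in> {1..int n + 1} - {int r} \<Longrightarrow> f (int r) - (int n + 1) < f y"
    and high: "\<And>y. y \<in> {1..int n + 1} - {top_pos r i} \<Longrightarrow> f y < f (top_pos r i) + (int n + 1)"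
    and sorted: "strict_mono_on {1..int n + 1} f"
  shows "strict_mono_on {1..int n + 1} (act n (u @ block n r i))"
proof (rule window_sorted_step[where f = f and p = "int r" and q = "top_pos r i"])
  have down: "act n u (z - (int n + 1)) = f z - (int n + 1)"
    and up: "act n u (z + (int n + 1)) = f z + (int n + 1)" for z
    using act_shift[of n u z "-1"] act_shift[of n u z 1] by (simp_all add: f algebra_simps)
  show "act n (u @ block n r i) 1 = f (int r) - (int n + 1)"
    using act_block(1)[OF n r i] down by simp
  show "act n (u @ block n r i) (int n + 1) = f (top_pos r i) + (int n + 1)"
    using act_block(2)[OF n r i] up by simp
  show "\<exists>y\<in>{1..int n + 1} - {int r, top_pos r i}. act n (u @ block n r i) z = f y"
    if "2 \<le> z" "z < int n + 1" for z
    using that mid_pos_range[OF r i, of z] act_block(3)[OF n r i, of z]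
    by (intro bexI[of _ "mid_pos r i z"]) (simp_all add: f)
  show "act n (u @ block n r i) y < act n (u @ block n r i) z"
    if "2 \<le> y" "y < z" "z < int n + 1" for y z
    using that mid_pos_range[OF r i, of y] mid_pos_range[OF r i, of z] mid_pos_strict_mono[of y z r i]
      act_block(3)[OF n r i] by (auto simp flip: f intro!: strict_mono_onD[OF sorted])
qed (use n r i low high top_pos_range(3)[of r i] in auto)

lemma block_bounds:
  assumes "pairwise_inequalities n m j i" "n \<ge> 2" "1 \<le> s" "s \<le> m"
  shows "1 \<le> j s" "j s \<le> n + 1" "i s < n"
proof -
  have "s = 1 \<or> s \<in> {2..m}" using assms(3,4) by auto
  then show "1 \<le> j s" "j s \<le> n + 1" "i s < n"
    using assms(1,2) unfolding pairwise_inequalities_def by fastforce+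
qed

text \<open>
  Let \<open>(r', i')\<close> and \<open>(r, i)\<close> be the parameters of two consecutive blocks, \<open>q'\<close> and \<open>q\<close> the
  corresponding top positions, \<open>g\<close> the product before these blocks, and \<open>f = g B (r', i')\<close>.
  Since \<open>f 1 = g r' - N\<close> and \<open>f N = g q' + N\<close>, sortedness is preserved if
  \<open>mid_pos r' i' r < r'\<close> and \<open>q' < mid_pos r' i' q\<close>.  The first follows from \<open>r \<le> r'\<close>,
  which is strict if \<open>r' > i' + 1\<close>; the second from \<open>i' \<le> i\<close>, which is strict if
  \<open>r > i + 1\<close>.  For the first block \<open>f\<close> is the identity and both comparisons are trivial.
\<close>

lemma blocks_sorted:
  assumes n: "n \<ge> 2" and P: "pairwise_inequalities n m j i" and "k \<le> m"
  shows "strict_mono_on {1..int n + 1} (act n (blocks n j i k))"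
  using assms(3)
proof (induction k rule: less_induct)
  case (less K)
  show ?case
  proof (cases K)
    case 0
    then show ?thesis by (simp add: blocks_def strict_mono_on_def)
  next
    case (Suc k)
    let ?N = "int n + 1" and ?r = "j (Suc k)" and ?i = "i (Suc k)"
    define f where "f = act n (blocks n j i k)"
    have sorted: "strict_mono_on {1..?N} f" using less Suc f_def by simp
    have le: "f y \<le> f z" if "1 \<le> y" "y \<le> z" "z \<le> ?N" for y z
      using strict_mono_onD[OF sorted, of y z] that by (cases "y = z") auto
    have r: "1 \<le> ?r" "?r \<le> n + 1" and i: "?i < n"
      using block_bounds[OF P n, of "Suc k"] less.prems Suc by auto
    note q = top_pos_range(1,2)[OF i, of ?r] top_pos_range(3)[of ?r ?i]
    have "(\<forall>y\<in>{1..?N} - {int ?r}. f (int ?r) - ?N < f y)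
      \<and> (\<forall>y\<in>{1..?N} - {top_pos ?r ?i}. f y < f (top_pos ?r ?i) + ?N)"
    proof (cases k)
      case 0
      then show ?thesis using r i q by (auto simp: f_def blocks_def)
    next
      case k: (Suc l)
      let ?r' = "j k" and ?i' = "i k"
      define g where "g = act n (blocks n j i l)"
      have sortedg: "strict_mono_on {1..?N} g" using less Suc k g_def by simp
      have r': "1 \<le> ?r'" "?r' \<le> n + 1" and i': "?i' < n"
        using block_bounds[OF P n, of k] less.prems Suc k by auto
      note q' = top_pos_range(1,2)[OF i', of ?r']
      have "Suc k \<in> {2..m}" using less.prems Suc k by auto
      then have ineqs: "?i = 0 \<and> ?r = 1 \<or> 1 \<le> ?i \<and> ?r \<le> n" "?r \<le> ?r'" "?i' \<le> ?i"
        "?r' > ?i' + 1 \<longrightarrow> ?r < ?r'" "?r > ?i + 1 \<longrightarrow> ?i > ?i'"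
        using P unfolding pairwise_inequalities_def by (metis diff_Suc_1)+
      have f: "f z = g (act n (block n ?r' ?i') z)" for z by (simp add: f_def g_def k blocks_Suc)
      have shift: "g (int ?r' - ?N) = g (int ?r') - ?N" "g (top_pos ?r' ?i' + ?N) = g (top_pos ?r' ?i') + ?N"
        using act_shift[of n "blocks n j i l" "int ?r'" "-1"]
          act_shift[of n "blocks n j i l" "top_pos ?r' ?i'" 1] by (simp_all add: g_def algebra_simps)
      have f1: "f 1 = g (int ?r') - ?N" and fN: "f ?N = g (top_pos ?r' ?i') + ?N"
        and fmid: "f z = g (mid_pos ?r' ?i' z)" if "2 \<le> z" "z \<le> int n" for z
        unfolding f by (simp_all add: act_block[OF n r' i'] shift that)
      \<comment> \<open>Unless \<open>r = 1\<close>, the value \<open>f r\<close> is given by \<open>mid_pos\<close>, as \<open>r = N\<close> can occur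
        only in the first block.\<close>
      have low: "f (int ?r) - ?N < f 1"
      proof (cases "?r = 1")
        case False
        then have R: "2 \<le> int ?r" "int ?r \<le> int n" using ineqs(1) r by auto
        have "mid_pos ?r' ?i' (int ?r) < int ?r'" using ineqs R by (auto simp: mid_pos_def Let_def)
        then have "f (int ?r) < g (int ?r')"
          unfolding fmid[OF R] using mid_pos_range[OF r' i' R] r' by (intro strict_mono_onD[OF sortedg]) auto
        then show ?thesis using f1[OF R] by simp
      qed simp
      \<comment> \<open>Likewise at the top position unless it is \<open>N\<close>; it is never \<open>1\<close> here because \<open>i = 0\<close> forces \<open>r = 1\<close>.\<close>
      have high: "f ?N < f (top_pos ?r ?i) + ?N"
      proof (cases "top_pos ?r ?i = ?N")
        case False
        then have R: "2 \<le> top_pos ?r ?i" "top_pos ?r ?i \<le> int n" using ineqs(1) q r by (auto simp: top_pos_def)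
        have "top_pos ?r' ?i' < mid_pos ?r' ?i' (top_pos ?r ?i)"
          using ineqs by (auto simp: mid_pos_def top_pos_def Let_def)
        then have "g (top_pos ?r' ?i') < f (top_pos ?r ?i)"
          unfolding fmid[OF R] using mid_pos_range[OF r' i' R] q' by (intro strict_mono_onD[OF sortedg]) auto
        then show ?thesis using fN[OF R] by simp
      qed simp
      show ?thesis using low high le by fastforce
    qed
    then show ?thesis using sorted_append_block[OF n r i f_def _ _ sorted] unfolding Suc blocks_Suc by blast
  qed
qed

lemma same_up_to_last:
  fixes n :: nat
  assumes "\<And>k. k \<in> {1..n} \<Longrightarrow> P k \<longleftrightarrow> Q k" "\<not> Q (n + 1)"
  shows "{k \<in> {1..n + 1}. Q k} \<subseteq> {k \<in> {1..n + 1}. P k}"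
    and "{k \<in> {1..n + 1}. P k} \<subseteq> insert (n + 1) {k \<in> {1..n + 1}. Q k}"
proof -
  have "Q k \<Longrightarrow> P k" "P k \<Longrightarrow> k = n + 1 \<or> Q k" if "k \<in> {1..n + 1}" for k
    using assms(1)[of k] assms(2) that by (cases "k = n + 1"; simp)+
  then show "{k \<in> {1..n + 1}. Q k} \<subseteq> {k \<in> {1..n + 1}. P k}"
    and "{k \<in> {1..n + 1}. P k} \<subseteq> insert (n + 1) {k \<in> {1..n + 1}. Q k}"
    by auto
qed

theorem mainTheorem3:
  fixes n m :: nat and j i :: "nat \<Rightarrow> nat" and w x :: "nat list set"
  assumes "n \<ge> 2" and "m \<ge> 1"
    and "w \<in> carrier (affine_W n)"
    and "affine_length n w = m"
    and "x \<in> finite_W n"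
    and "pairwise_inequalities n m j i"
    and "w = word_prod (affine_W n) (map (\<lambda>s. affine_B n (j s) (i s)) [1..<Suc m])
             \<otimes>\<^bsub>affine_W n\<^esub> x"
  shows "right_desc n x \<subseteq> right_desc n w \<and> right_desc n w \<subseteq> right_desc n x \<union> {a_gen n} \<and>
         (right_desc n w = right_desc n x \<or> right_desc n w = right_desc n x \<union> {a_gen n})"
proof -
  note n = assms(1)
  obtain v where v: "v \<in> lists {1..n}" "x = cls n v" using finite_W_word[OF assms(5)] .
  have vl: "v \<in> lists {1..n+1}" using v(1) by auto
  let ?u = "blocks n j i m" and ?N = "int n + 1"
  have bl: "block n (j s) (i s) \<in> lists {1..n+1}" "affine_B n (j s) (i s) = cls n (block n (j s) (i s))"
    if "s \<in> set [1..<Suc m]" for s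
  proof -
    have "1 \<le> j s" "i s \<le> n" using block_bounds[OF assms(6) n, of s] that by auto
    then show "block n (j s) (i s) \<in> lists {1..n+1}" "affine_B n (j s) (i s) = cls n (block n (j s) (i s))"
      by (rule block_lists, rule affine_B_block)
  qed
  have ul: "?u \<in> lists {1..n+1}" unfolding blocks_def
  proof (rule concat_in_lists)
    fix b assume "b \<in> set (map (\<lambda>s. block n (j s) (i s)) [1..<Suc m])"
    then obtain s where "s \<in> set [1..<Suc m]" "b = block n (j s) (i s)" unfolding set_map by (rule imageE)
    then show "b \<in> lists {1..n+1}" using bl(1)[of s] by (simp only:)
  qed
  have "map (\<lambda>s. affine_B n (j s) (i s)) [1..<Suc m] = map (\<lambda>s. cls n (block n (j s) (i s))) [1..<Suc m]"
    using bl(2) by (rule map_cong[OF HOL.refl])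
  then have "word_prod (affine_W n) (map (\<lambda>s. affine_B n (j s) (i s)) [1..<Suc m]) = cls n ?u"
    using word_prod_cls[of "[1..<Suc m]" "\<lambda>s. block n (j s) (i s)" n, OF bl(1)]
    by (simp only: blocks_def)
  then have "w = cls n (?u @ v)"
    using assms(7) v(2) cls_mult[OF ul vl] by (simp only:)
  then have Rw: "right_desc n w = (\<lambda>k. cls n [k]) ` {k \<in> {1..n+1}. act n (?u @ v) (int k + 1) < act n (?u @ v) (int k)}"
    using right_desc_cls[OF n, of "?u @ v"] ul vl by simp
  have Rx: "right_desc n x = (\<lambda>k. cls n [k]) ` {k \<in> {1..n+1}. act n v (int k + 1) < act n v (int k)}"
    using right_desc_cls[OF n vl] v(2) by simp
  have range: "act n v z \<in> {1..?N}" if "1 \<le> z" "z \<le> ?N" for z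
    using act_finite_range[OF n v(1)] that by simp
  have desc: "act n (?u @ v) (int k + 1) < act n (?u @ v) (int k) \<longleftrightarrow> act n v (int k + 1) < act n v (int k)"
    if "k \<in> {1..n}" for k
    using that range[of "int k"] range[of "int k + 1"]
    by (simp add: strict_mono_on_less[OF blocks_sorted[OF n assms(6) order.refl]])
  have "\<not> act n v (int (n + 1) + 1) < act n v (int (n + 1))"
    using act_shift[of n v 1 1] range[of 1] range[of ?N] by (simp add: algebra_simps)
  note * = same_up_to_last[where n = n
      and P = "\<lambda>k. act n (?u @ v) (int k + 1) < act n (?u @ v) (int k)"
      and Q = "\<lambda>k. act n v (int k + 1) < act n v (int k)", OF desc this]
  have "right_desc n x \<subseteq> right_desc n w" "right_desc n w \<subseteq> insert (cls n [n + 1]) (right_desc n x)"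
    unfolding Rw Rx
    using image_mono[OF *(1), of "\<lambda>k. cls n [k]"] image_mono[OF *(2), of "\<lambda>k. cls n [k]"]
    by (simp_all only: image_insert)
  then have "right_desc n x \<subseteq> right_desc n w" "right_desc n w \<subseteq> right_desc n x \<union> {a_gen n}"
    by (simp_all add: a_gen_cls)
  then show ?thesis by blast
qed

end
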